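(* Let $n\ge 1$ and let $f(X)=a_0+a_1X+\cdots+a_nX^n$ be a polynomial with integer coefficients, with $|a_n|>2|a_{n-1}|+2^2|a_{n-2}|+\cdots+2^n|a_0|$ and $a_0\neq 0$. If $f(\mathbb{Z}\setminus\{0\})$ or $-f(\mathbb{Z}\setminus\{0\})$ contains a prime number, then $f$ is irreducible over $\mathbb{Q}$.
   Context: Here $f(\mathbb{Z}\setminus\{0\})=\{f(m): m\in\mathbb{Z},\ m\neq 0\}$ and $-f(\mathbb{Z}\setminus\{0\})=\{-f(m): m\in\mathbb{Z},\ m\neq 0\}$. *)

theory Defs
  imports "HOL-Computational_Algebra.Computational_Algebra"
begin

end

theory Submission
  imports Defs
begin

text \<open>
  The coefficient condition puts every complex root of \<open>f\<close> in the disc \<open>\<bar>z\<bar> < 1/2\<close>, so every root is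
  closer to \<open>0\<close> than to a nonzero integer \<open>m\<close>. Hence every nonconstant integer factor \<open>g\<close> of \<open>f\<close>
  satisfies \<open>\<bar>g(m)\<bar> > \<bar>g(0)\<bar> \<ge> 1\<close>, and a nontrivial factorization of \<open>f\<close>, which by Gauss's lemma
  can be taken over the integers, would factor the prime \<open>\<bar>f(m)\<bar>\<close> properly.
\<close>

text \<open>Passing from radius \<open>r\<close> to a radius \<open>norm z\<close> at least
  \<open>r\<close> multiplies the term of index \<open>i\<close> by \<open>(norm z / r) ^ i\<close>,
  which is largest for \<open>i = n\<close>. So the top term still dominates the sum of the others
  at \<open>z\<close>, and they cannot cancel.\<close>

lemma norm_root_less:
  fixes c :: "nat \<Rightarrow> 'a :: real_normed_field" and r :: real
  assumes r: "r > 0"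
    and dom: "(\<Sum>i<n. norm (c i) * r ^ i) < norm (c n) * r ^ n"
    and root: "(\<Sum>i\<le>n. c i * z ^ i) = 0"
  shows "norm z < r"
proof (rule ccontr)
  assume "\<not> norm z < r"
  hence z: "r \<le> norm z" by simp
  have "c n * z ^ n = - (\<Sum>i<n. c i * z ^ i)"
    using root by (simp add: lessThan_Suc_atMost [symmetric] eq_neg_iff_add_eq_0 add.commute)
  hence "norm (c n) * norm z ^ n = norm (\<Sum>i<n. c i * z ^ i)"
    by (metis norm_minus_cancel norm_mult norm_power)
  also have "\<dots> \<le> (\<Sum>i<n. norm (c i) * norm z ^ i)"
    by (rule order_trans [OF norm_sum]) (simp add: norm_mult norm_power)
  \<comment> \<open>The factor \<open>r ^ n\<close> allows the scaling by \<open>norm z / r\<close>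
    to be compared without division: \<open>r ^ (n - i)\<close> is traded for
    \<open>norm z ^ (n - i)\<close> in each term.\<close>
  finally have "norm (c n) * norm z ^ n * r ^ n \<le> (\<Sum>i<n. norm (c i) * norm z ^ i) * r ^ n"
    using r by simp
  also have "\<dots> \<le> (\<Sum>i<n. norm (c i) * r ^ i) * norm z ^ n"
    unfolding sum_distrib_right
  proof (rule sum_mono)
    fix i assume "i \<in> {..<n}"
    hence n: "n = i + (n - i)" by simp
    have "r ^ (n - i) \<le> norm z ^ (n - i)"
      using r z by (intro power_mono) auto
    hence "norm (c i) * norm z ^ i * r ^ i * r ^ (n - i)
        \<le> norm (c i) * norm z ^ i * r ^ i * norm z ^ (n - i)"
      using r by (intro mult_left_mono) auto
    thus "norm (c i) * norm z ^ i * r ^ n \<le> norm (c i) * r ^ i * norm z ^ n"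
      by (subst (1 2) n) (simp only: power_add ac_simps)
  qed
  also have "\<dots> < norm (c n) * r ^ n * norm z ^ n"
    using dom r z by (intro mult_strict_right_mono zero_less_power) auto
  finally show False by (simp add: ac_simps)
qed

text \<open>Over the complex numbers \<open>p\<close> is a constant times a product of factors X - z
  over its roots, and each factor is smaller in norm at 0 than at \<open>w\<close>. The induction
  splits off one root at a time.\<close>

lemma norm_poly_0_less:
  fixes p :: "complex poly"
  assumes "degree p > 0"
    and "\<And>z. poly p z = 0 \<Longrightarrow> norm z < norm (w - z)"
  shows "norm (poly p 0) < norm (poly p w)"
  using assms
proof (induction "degree p" arbitrary: p rule: less_induct)
  case less
  obtain z where z: "poly p z = 0"
    using less.prems(1) fundamental_theorem_of_algebra [of p] by (auto simp: constant_degree)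
  then obtain q where p: "p = [:-z, 1:] * q"
    by (auto simp: poly_eq_0_iff_dvd)
  have "p \<noteq> 0" using less.prems(1) by auto
  hence deg: "degree p = Suc (degree q)"
    using p by (auto simp: degree_mult_eq simp del: mult_pCons_left)
  have zw: "norm z < norm (w - z)"
    using less.prems(2) z .
  \<comment> \<open>If \<open>w\<close> were a root, the hypothesis would give
    \<open>norm w < 0\<close>.\<close>
  have "poly p w \<noteq> 0"
    using less.prems(2) [of w] by auto
  hence pos: "norm (poly q w) > 0" by (auto simp: p)
  \<comment> \<open>Only a weak inequality is available, since \<open>q\<close> may be constant;
    strictness comes from the root \<open>z\<close>.\<close>
  have "norm (poly q 0) \<le> norm (poly q w)"
  proof (cases "degree q = 0")
    case True
    thus ?thesis by (auto elim: degree_eq_zeroE)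
  next
    case False
    have "norm (poly q 0) < norm (poly q w)"
      by (rule less.hyps) (use False deg less.prems(2) in \<open>auto simp: p\<close>)
    thus ?thesis by simp
  qed
  hence "norm z * norm (poly q 0) \<le> norm z * norm (poly q w)"
    by (intro mult_left_mono) auto
  also have "\<dots> < norm (w - z) * norm (poly q w)"
    using zw pos by (rule mult_strict_right_mono)
  finally show ?case
    by (simp add: p norm_mult [symmetric] algebra_simps)
qed

lemma rat_poly_clear_denominators:
  fixes q :: "rat poly"
  obtains d :: int and g :: "int poly"
  where "d \<noteq> 0" "smult (of_int d) q = map_poly of_int g"
proof -
  have "\<exists>d g. d \<noteq> (0::int) \<and> smult (of_int d) q = map_poly of_int g"
  proof (induction q)
    case 0
    show ?case by (intro exI [of _ 1] exI [of _ 0]) simp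
  next
    case (pCons c q)
    then obtain d g where d: "d \<noteq> 0" and g: "smult (of_int d) q = map_poly of_int g"
      by blast
    obtain a b where b: "b > 0" and c: "c = of_int a / of_int b"
      by (metis Rat_cases Fract_of_int_quotient)
    have "smult (of_int (b * d)) (pCons c q) = pCons (of_int (a * d)) (smult (of_int b) (map_poly of_int g))"
      using b by (simp add: c g [symmetric])
    also have "\<dots> = map_poly of_int (pCons (a * d) (smult b g))"
      by (intro poly_eqI) (simp add: coeff_map_poly coeff_pCons split: nat.split)
    finally show ?case using b d
      by (intro exI [of _ "b * d"] exI [of _ "pCons (a * d) (smult b g)"]) auto
  qed
  thus ?thesis using that by blast
qed

lemma map_poly_of_int_eq_iff:
  "map_poly (of_int :: int \<Rightarrow> 'a :: ring_char_0) p = map_poly of_int q \<longleftrightarrow> p = q"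
  by (simp add: poly_eq_iff coeff_map_poly)

lemma map_poly_of_int_mult:
  "map_poly (of_int :: int \<Rightarrow> 'a :: comm_ring_1) (p * q) = map_poly of_int p * map_poly of_int q"
  by (intro poly_eqI) (simp add: coeff_map_poly coeff_mult)

lemma map_poly_of_int_smult:
  "map_poly (of_int :: int \<Rightarrow> 'a :: comm_ring_1) (smult c p) = smult (of_int c) (map_poly of_int p)"
  by (intro poly_eqI) (simp add: coeff_map_poly)

lemma poly_map_poly_of_int:
  "poly (map_poly (of_int :: int \<Rightarrow> 'a :: comm_ring_1) p) (of_int m) = of_int (poly p m)"
  by (induction p) (simp_all add: map_poly_pCons)

text \<open>Gauss's lemma: clearing denominators gives a factorization of an integer multiple of
  \<open>f\<close>, and the multiplicativity of primitive parts removes the extra constant without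
  changing degrees.\<close>

lemma rat_factorization_imp_int_factorization:
  fixes f :: "int poly" and q r :: "rat poly"
  assumes qr: "map_poly of_int f = q * r" and f: "f \<noteq> 0"
  obtains g h where "f = g * h" "degree g = degree q" "degree h = degree r"
proof -
  obtain d g where d: "d \<noteq> 0" and g: "smult (of_int d) q = map_poly of_int g"
    by (rule rat_poly_clear_denominators)
  obtain e h where e: "e \<noteq> 0" and h: "smult (of_int e) r = map_poly of_int h"
    by (rule rat_poly_clear_denominators)
  have "map_poly rat_of_int (smult (d * e) f) = map_poly of_int (g * h)"
    by (simp add: map_poly_of_int_mult map_poly_of_int_smult qr g [symmetric] h [symmetric] mult.commute)
  hence gh: "smult (d * e) f = g * h"
    by (simp only: map_poly_of_int_eq_iff)
  have degs: "degree g = degree q" "degree h = degree r"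
    using arg_cong [OF g, of degree] arg_cong [OF h, of degree] d e by (simp_all add: degree_map_poly)
  \<comment> \<open>Of the constant \<open>d * e\<close>, only its sign survives in the primitive
    part. The sign is its own inverse, so it can be moved to the other side and absorbed, with the
    content of \<open>f\<close>, into the first factor.\<close>
  have "smult (unit_factor (d * e)) (primitive_part f) = primitive_part g * primitive_part h"
    using arg_cong [OF gh, of primitive_part] by (simp add: primitive_part_mult primitive_part_smult)
  moreover have "unit_factor (d * e) * unit_factor (d * e) = 1"
    using d e by (simp add: unit_factor_int_def sgn_mult_self_eq)
  ultimately have "primitive_part f = smult (unit_factor (d * e)) (primitive_part g * primitive_part h)"
    by (metis smult_smult smult_1_left)
  hence "f = smult (content f * unit_factor (d * e)) (primitive_part g) * primitive_part h"
    by (metis content_times_primitive_part mult_smult_left smult_smult)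
  moreover have "content f * unit_factor (d * e) \<noteq> 0"
    using f d e by (simp add: sgn_mult sgn_eq_0_iff)
  hence "degree (smult (content f * unit_factor (d * e)) (primitive_part g)) = degree q"
    by (simp only: degree_smult_eq degree_primitive_part degs if_False)
  moreover have "degree (primitive_part h) = degree r"
    by (simp add: degs)
  ultimately show ?thesis
    by (rule that)
qed

theorem corollary1p5:
  fixes n :: nat and a :: "nat \<Rightarrow> int" and f :: "int poly"
  assumes "n \<ge> 1"
    and "f = (\<Sum>i=0..n. monom (a i) i)"
    and "\<bar>a n\<bar> > (\<Sum>i=1..n. 2 ^ i * \<bar>a (n - i)\<bar>)"
    and "a 0 \<noteq> 0"
    and "(\<exists>p \<in> {poly f m |m. m \<noteq> 0}. prime p) \<or> (\<exists>p \<in> {- poly f m |m. m \<noteq> 0}. prime p)"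
  shows "irreducible (map_poly rat_of_int f)"
proof -
  have coeff_f: "coeff f i = (if i \<le> n then a i else 0)" for i
    by (auto simp: assms(2) coeff_sum)
  have "0 \<le> (\<Sum>i=1..n. 2 ^ i * \<bar>a (n - i)\<bar>)"
    by (intro sum_nonneg) auto
  hence "a n \<noteq> 0" using assms(3) by auto
  hence deg_f: "degree f = n"
    by (intro antisym degree_le le_degree) (auto simp: coeff_f)
  have f0: "f \<noteq> 0" using deg_f assms(1) by auto

  obtain m where m: "m \<noteq> 0" and "prime (poly f m) \<or> prime (- poly f m)"
    using assms(5) by auto
  \<comment> \<open>On integers \<open>prime\<close> includes positivity, whereas
    \<open>prime_elem\<close> ignores the sign, so the two cases merge.\<close>
  hence prime_fm: "prime_elem (poly f m)"
    by (metis normalize_uminus prime_elem_normalize_iff prime_imp_prime_elem)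

  have root_bound: "norm z < 1 / 2" if "poly (map_poly complex_of_int f) z = 0" for z
  proof (rule norm_root_less)
    show "(\<Sum>i\<le>n. complex_of_int (a i) * z ^ i) = 0"
      using that by (simp add: poly_altdef degree_map_poly deg_f coeff_map_poly coeff_f)
    \<comment> \<open>Reversing the order of summation and then multiplying by
      \<open>(1 / 2) ^ n\<close> turns the coefficient hypothesis into dominance of the top term at
      radius 1/2.\<close>
    have "(\<Sum>i=1..n. 2 ^ i * \<bar>a (n - i)\<bar>) = (\<Sum>i<n. 2 ^ (n - i) * \<bar>a i\<bar>)"
      by (rule sum.reindex_bij_witness [of _ "\<lambda>i. n - i" "\<lambda>i. n - i"]) auto
    hence "(\<Sum>i<n. 2 ^ (n - i) * \<bar>a i\<bar>) < \<bar>a n\<bar>"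
      using assms(3) by simp
    hence "real_of_int (\<Sum>i<n. 2 ^ (n - i) * \<bar>a i\<bar>) < of_int \<bar>a n\<bar>"
      by (simp only: of_int_less_iff)
    hence "(\<Sum>i<n. 2 ^ (n - i) * \<bar>real_of_int (a i)\<bar>) * (1 / 2) ^ n < \<bar>real_of_int (a n)\<bar> * (1 / 2) ^ n"
      by (intro mult_strict_right_mono) auto
    moreover have "(\<Sum>i<n. 2 ^ (n - i) * \<bar>real_of_int (a i)\<bar>) * (1 / 2) ^ n
        = (\<Sum>i<n. \<bar>real_of_int (a i)\<bar> * (1 / 2) ^ i)"
      unfolding sum_distrib_right
      by (rule sum.cong) (auto simp: power_diff power_divide)
    ultimately show "(\<Sum>i<n. norm (complex_of_int (a i)) * (1 / 2) ^ i)
        < norm (complex_of_int (a n)) * (1 / 2) ^ n"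
      by simp
  qed simp

  have factor_at_m: "\<not> is_unit (poly g m)" if gh: "f = g * h" and deg: "degree g > 0" for g h
  proof -
    have "norm (poly (map_poly complex_of_int g) 0) < norm (poly (map_poly complex_of_int g) (of_int m))"
    proof (rule norm_poly_0_less)
      show "degree (map_poly complex_of_int g) > 0"
        using deg by (simp add: degree_map_poly)
      fix z assume "poly (map_poly complex_of_int g) z = 0"
      hence "norm z < 1 / 2"
        by (intro root_bound) (simp add: gh map_poly_of_int_mult)
      \<comment> \<open>The reverse triangle inequality gives |m - z| \<ge> |m| - |z| > 1/2 >
        |z|.\<close>
      moreover have "\<bar>real_of_int m\<bar> \<ge> 1"
        using m by linarith
      hence "1 \<le> norm (complex_of_int m)"
        by simp
      ultimately show "norm z < norm (of_int m - z)"
        using norm_triangle_ineq2 [of "complex_of_int m" z] by linarith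
    qed
    hence "\<bar>poly g 0\<bar> < \<bar>poly g m\<bar>"
      using poly_map_poly_of_int [of g 0, where ?'a = complex]
      by (simp add: poly_map_poly_of_int)
    \<comment> \<open>Since g(0) divides f(0) = \<open>a 0\<close>, it is a nonzero integer, so
      |g(m)| > |g(0)| \<ge> 1 and g(m) is not a unit.\<close>
    moreover have "poly f 0 \<noteq> 0"
      using assms(4) by (simp add: poly_0_coeff_0 coeff_f)
    hence "poly g 0 \<noteq> 0" by (simp add: gh)
    ultimately show ?thesis by (simp add: zdvd1_eq)
  qed

  show ?thesis
  proof (rule irreducibleI)
    show "map_poly rat_of_int f \<noteq> 0"
      using f0 map_poly_of_int_eq_iff [of f 0, where ?'a = rat] by simp
    show "\<not> is_unit (map_poly rat_of_int f)"
      using assms(1) by (auto simp: is_unit_poly_iff deg_f dest!: arg_cong [of _ _ degree] simp: degree_map_poly)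
  next
    fix q r assume qr: "map_poly rat_of_int f = q * r"
    then obtain g h where gh: "f = g * h" "degree g = degree q" "degree h = degree r"
      using f0 by (rule rat_factorization_imp_int_factorization)
    have "q \<noteq> 0" "r \<noteq> 0"
      using qr f0 map_poly_of_int_eq_iff [of f 0, where ?'a = rat] by auto
    \<comment> \<open>One of the two factors of the prime element f(m) is a unit, so the
      corresponding polynomial is constant. The rational factor of the same degree is then a nonzero
      constant, hence a unit.\<close>
    moreover have "is_unit (poly g m) \<or> is_unit (poly h m)"
      using prime_elem_imp_irreducible [OF prime_fm] by (rule irreducibleD) (simp add: gh)
    hence "degree q = 0 \<or> degree r = 0"
      using factor_at_m [of g h] factor_at_m [of h g] gh by (auto simp: mult.commute)
    ultimately show "is_unit q \<or> is_unit r"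
      by (auto simp: is_unit_iff_degree)
  qed
qed

end
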